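(* Consider the FedRK algorithm (described in the context) applied to an overdetermined linear system $Ax=b$ whose solution is $x^*=0$, with $\tau=\infty$ local iterations per client, with a finite number $\tau_g=T\in\mathbb{N}$, $T\ge1$, of server iterations per federated round, and with $|S^{(t)}|=N$ for all $t$, where $N\in\mathbb{N}$, $1\le N\le M$, is fixed. Let $X^{(0)}\in\mathbb{R}^n$ be the initial global model and let $X^{(t+1)}$ be the global model after $t+1$ federated rounds. Then there exists $0<\beta<1$ such that $$\mathbb{E}\Vert X^{(t+1)}\Vert^2\le\beta^{t+1}\Vert X^{(0)}\Vert^2,\qquad t=0,1,2,\dotsc.$$
   Context: Setting. $A\in\mathbb{R}^{m\times n}$ and $b\in\mathbb{R}^m$ are partitioned by rows into $M$ blocks $A_1,\dots,A_M$ and $b_1,\dots,b_M$; client $i\in[M]=\{1,\dots,M\}$ holds the system $A_ix=b_i$ (which may be underdetermined). The full system $Ax=b$ is consistent and overdetermined, with unique solution $x^*=0$ (so $b=0$ and $Ax=0$ only for $x=0$). Write $C_i=\{x\in\mathbb{R}^n:A_ix=b_i\}$, which is a linear subspace, and let $P_{C_i}$ be the orthogonal projection onto $C_i$. $\Vert\cdot\Vert$ is the Euclidean norm. FedRK with $\tau=\infty$. Running infinitely many local randomized Kaczmarz iterations on $A_ix=b_i$ from $X^{(t)}$ yields the limit $P_{C_i}X^{(t)}$. Start from the deterministic initial model $X^{(0)}$. In round $t=0,1,2,\dots$: (1) a subset $S^{(t)}\subseteq[M]$ of clients with $|S^{(t)}|=N$ is sampled uniformly at random among all $N$-element subsets;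 (2) each client $i\in S^{(t)}$ computes $\Delta_i^{(t)}=P_{C_i}X^{(t)}-X^{(t)}$; (3) with $d_i=\langle\Delta_i^{(t)},\Delta_i^{(t)}+X^{(t)}\rangle$ for $i\in S^{(t)}$, the server performs $\tau_g$ randomized Kaczmarz steps, started at $X^{(t)}$, on the system $\langle\Delta_i^{(t)},x\rangle=d_i$, $i\in S^{(t)}$: rows with $\Delta_i^{(t)}=0$ are ignored, and each step samples an index $i$ uniformly among the remaining ones and replaces the current point $x$ by $x+\frac{d_i-\langle\Delta_i^{(t)},x\rangle}{\Vert\Delta_i^{(t)}\Vert^2}\Delta_i^{(t)}$. The result after $\tau_g$ steps is $X^{(t+1)}$ (if all $\Delta_i^{(t)}=0$, then $X^{(t+1)}=X^{(t)}$). All random choices are made independently of each other and of the past, given the current state. *)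

theory Defs
  imports "HOL-Analysis.Analysis" "HOL-Probability.Probability"
begin

definition client_solutions :: "real^'n^'m \<Rightarrow> real^'m \<Rightarrow> 'm set \<Rightarrow> (real^'n) set" where
  "client_solutions A b I = {x. \<forall>r\<in>I. (A *v x) $ r = b $ r}"

text \<open>
  The projection onto a client's solution set is the library's nearest-point map. On a subspace it
  is the orthogonal projection:
\<close>

lemma closest_point_subspace_iff:
  fixes S :: "'a::euclidean_space set"
  assumes "subspace S"
  shows "closest_point S x = p \<longleftrightarrow> p \<in> S \<and> (\<forall>y\<in>S. orthogonal (x - p) y)"
proof -
  have S: "convex S" "closed S" "S \<noteq> {}"
    using assms subspace_imp_convex closed_subspace subspace_0 by auto
  have 1: "orthogonal (x - closest_point S x) y" if "y \<in> S" for y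
  proof -
    let ?q = "closest_point S x"
    have q: "?q \<in> S" using S by (simp add: closest_point_in_set)
    have "(x - ?q) \<bullet> ((?q + y) - ?q) \<le> 0" "(x - ?q) \<bullet> ((?q - y) - ?q) \<le> 0"
      using closest_point_dot[OF S(1,2), of "?q + y" x] closest_point_dot[OF S(1,2), of "?q - y" x]
        subspace_add[OF assms q that] subspace_diff[OF assms q that] by blast+
    then show ?thesis by (simp add: orthogonal_def)
  qed
  have 2: "closest_point S x = p" if p: "p \<in> S" "\<forall>y\<in>S. orthogonal (x - p) y"
  proof -
    have "dist x p \<le> dist x z" if z: "z \<in> S" for z
    proof -
      have "orthogonal (x - p) (p - z)" using p z assms by (simp add: subspace_diff)
      then have "(norm ((x - p) + (p - z)))\<^sup>2 = (norm (x - p))\<^sup>2 + (norm (p - z))\<^sup>2"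
        by (rule norm_add_Pythagorean)
      then have "(norm (x - p))\<^sup>2 \<le> (norm (x - z))\<^sup>2" by simp
      then show ?thesis by (simp add: dist_norm)
    qed
    then show ?thesis using closest_point_unique[OF S(1,2) p(1)] by simp
  qed
  show ?thesis using 1 2 closest_point_in_set[OF S(2,3)] by blast
qed

text \<open>Below, \<open>R i\<close> is the set of rows of the full system held by client \<open>i\<close>.\<close>

definition local_update ::
  "real^'n^'m \<Rightarrow> real^'m \<Rightarrow> (nat \<Rightarrow> 'm set) \<Rightarrow> real^'n \<Rightarrow> nat \<Rightarrow> real^'n" where
  "local_update A b R X i = closest_point (client_solutions A b (R i)) X - X"

definition server_step ::
  "(nat \<Rightarrow> real^'n) \<Rightarrow> (nat \<Rightarrow> real) \<Rightarrow> nat set \<Rightarrow> real^'n \<Rightarrow> (real^'n) pmf" where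
  "server_step \<Delta> d S x =
     (let J = {i\<in>S. \<Delta> i \<noteq> 0} in
      if J = {} then return_pmf x
      else map_pmf (\<lambda>i. x + ((d i - \<Delta> i \<bullet> x) / (norm (\<Delta> i))\<^sup>2) *\<^sub>R \<Delta> i) (pmf_of_set J))"

primrec server_iterate ::
  "(nat \<Rightarrow> real^'n) \<Rightarrow> (nat \<Rightarrow> real) \<Rightarrow> nat set \<Rightarrow> nat \<Rightarrow> real^'n \<Rightarrow> (real^'n) pmf" where
  "server_iterate \<Delta> d S 0 x = return_pmf x"
| "server_iterate \<Delta> d S (Suc k) x =
     bind_pmf (server_iterate \<Delta> d S k x) (server_step \<Delta> d S)"

text \<open>The one-round transition kernel, for \<open>N\<close> participating clients and \<open>T\<close> server steps:\<close>

definition fedrk_round ::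
  "real^'n^'m \<Rightarrow> real^'m \<Rightarrow> (nat \<Rightarrow> 'm set) \<Rightarrow> nat \<Rightarrow> nat \<Rightarrow> nat \<Rightarrow> real^'n \<Rightarrow> (real^'n) pmf" where
  "fedrk_round A b R M N T X =
     bind_pmf (pmf_of_set {S. S \<subseteq> {1..M} \<and> card S = N}) (\<lambda>S.
       let \<Delta> = local_update A b R X;
           d = (\<lambda>i. \<Delta> i \<bullet> (\<Delta> i + X))
       in server_iterate \<Delta> d S T X)"

text \<open>The distribution of the global model after \<open>t\<close> rounds:\<close>

primrec fedrk ::
  "real^'n^'m \<Rightarrow> real^'m \<Rightarrow> (nat \<Rightarrow> 'm set) \<Rightarrow> nat \<Rightarrow> nat \<Rightarrow> nat \<Rightarrow> real^'n \<Rightarrow> nat \<Rightarrow> (real^'n) pmf" where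
  "fedrk A b R M N T X0 0 = return_pmf X0"
| "fedrk A b R M N T X0 (Suc t) = bind_pmf (fedrk A b R M N T X0 t) (fedrk_round A b R M N T)"

text \<open>All these distributions have finite support, so expectations under them are finite sums:\<close>

lemma finite_set_pmf_server_iterate:
  assumes "finite S"
  shows "finite (set_pmf (server_iterate \<Delta> d S k x))"
  using assms by (induction k) (auto simp: server_step_def Let_def)

lemma finite_set_pmf_fedrk:
  assumes "N \<le> M"
  shows "finite (set_pmf (fedrk A b R M N T X0 t))"
proof (induction t)
  case (Suc t)
  let ?F = "{S. S \<subseteq> {1..M} \<and> card S = N}"
  have "?F \<noteq> {}" using obtain_subset_with_card_n[of N "{1..M}"] assms by auto
  moreover have "finite ?F" by (rule finite_subset[of _ "Pow {1..M}"]) auto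
  ultimately show ?case
    using Suc finite_subset[OF _ finite_atLeastAtMost[of 1 M]]
    by (auto simp: fedrk_round_def Let_def intro!: finite_set_pmf_server_iterate)
qed simp

end

theory Submission
  imports Defs
begin

text \<open>
  Since the solution is zero, \<open>b = 0\<close> and every client's solution set is a subspace. The residual
  \<open>\<Delta> i\<close> is orthogonal to that subspace, hence to \<open>\<Delta> i + X\<close>, so every right-hand side \<open>d i\<close> of the
  server's system vanishes (\<open>local_update_orthogonal\<close>). A server step is therefore the orthogonal
  projection onto the hyperplane \<open>(\<Delta> i)\<^sup>\<bottom>\<close>. It never increases the norm, and the first step of a
  round, which starts at \<open>X\<close> itself, lands exactly on the projection \<open>\<Delta> i + X\<close> and lowers the
  squared norm by \<open>(norm (\<Delta> i))\<^sup>2\<close>. Later steps can only help, so a round with participants \<open>S\<close>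
  lowers the expected squared norm by at least the average of \<open>(norm (\<Delta> i))\<^sup>2\<close> over \<open>S\<close>
  (\<open>server_iterate_decrease\<close>).

  It remains to see that these decreases are a fixed fraction of \<open>(norm X)\<^sup>2\<close>. In a row \<open>r\<close> held
  by client \<open>i\<close> the vectors \<open>A *v X\<close> and \<open>- (A *v \<Delta> i)\<close> have the same entry, because \<open>\<Delta> i + X\<close>
  solves that row. The rows cover the whole system, so \<open>norm (A *v X)\<close> is controlled by the
  residuals of all clients; and \<open>A\<close> is injective, so \<open>norm (A *v X)\<close> controls \<open>norm X\<close>
  (\<open>sum_local_update_lower_bound\<close>). Every client participates with positive probability, which
  gives a contraction factor for one round that does not depend on \<open>X\<close> (\<open>fedrk_round_contraction\<close>);
  the Markov property multiplies these factors over the rounds.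
\<close>

section \<open>Expectations under finitely supported distributions\<close>

lemma expectation_bind_le:
  fixes g :: "'a \<Rightarrow> real" and h :: "'b \<Rightarrow> real"
  assumes fin: "finite (set_pmf p)" "\<And>x. x \<in> set_pmf p \<Longrightarrow> finite (set_pmf (f x))"
    and le: "\<And>x. x \<in> set_pmf p \<Longrightarrow> measure_pmf.expectation (f x) g \<le> h x"
  shows "measure_pmf.expectation (bind_pmf p f) g \<le> measure_pmf.expectation p h"
proof -
  have "measure_pmf.expectation (bind_pmf p f) g =
      (\<Sum>x\<in>set_pmf p. pmf p x *\<^sub>R measure_pmf.expectation (f x) g)"
    using fin by (intro pmf_expectation_bind) auto
  also have "\<dots> \<le> (\<Sum>x\<in>set_pmf p. pmf p x * h x)"
    by (auto intro!: sum_mono mult_left_mono le)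
  also have "\<dots> = measure_pmf.expectation p h"
    using integral_measure_pmf_real[OF fin(1), of p h] by (simp add: mult.commute)
  finally show ?thesis .
qed

section \<open>The local updates\<close>

lemma subspace_client_solutions:
  "subspace (client_solutions A 0 I)"
  by (auto simp: subspace_def client_solutions_def matrix_vector_right_distrib
      matrix_vector_mult_scaleR)

lemma closest_point_local_update:
  "closest_point (client_solutions A b (R i)) X = local_update A b R X i + X"
  by (simp add: local_update_def)

lemma local_update_solves:
  "local_update A 0 R X i + X \<in> client_solutions A 0 (R i)"
  using closest_point_subspace_iff[OF subspace_client_solutions]
  by (metis closest_point_local_update)

lemma local_update_orthogonal:
  "local_update A 0 R X i \<bullet> (local_update A 0 R X i + X) = 0"
proof -
  let ?p = "local_update A 0 R X i + X"
  have "orthogonal (X - ?p) ?p"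
    using closest_point_subspace_iff[OF subspace_client_solutions]
    by (metis closest_point_local_update)
  then show ?thesis
    by (simp add: orthogonal_def)
qed

text \<open>
  In a row of client \<open>i\<close> the entry of \<open>A *v X\<close> is, up to sign, that of \<open>A *v \<Delta> i\<close>. Bounding that
  one client's entry by the sum over all clients makes the estimate uniform in the row.
\<close>

lemma norm_residual_le_sum_local_update:
  fixes A :: "real^'n^'m"
  assumes "finite K" "(\<Union>i\<in>K. R i) = UNIV"
  shows "(norm (A *v X))\<^sup>2 \<le> (\<Sum>i\<in>K. (norm (A *v local_update A 0 R X i))\<^sup>2)"
proof -
  let ?D = "local_update A 0 R X"
  have row: "((A *v X) $ r)\<^sup>2 \<le> (\<Sum>i\<in>K. ((A *v ?D i) $ r)\<^sup>2)" for r
  proof -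
    obtain i where i: "i \<in> K" "r \<in> R i"
      using assms(2) by blast
    have "(A *v ?D i) $ r + (A *v X) $ r = 0"
      using local_update_solves[of A R X i] i(2)
      by (simp add: client_solutions_def matrix_vector_right_distrib)
    then have "(A *v X) $ r = - (A *v ?D i) $ r"
      by simp
    then have "((A *v X) $ r)\<^sup>2 = ((A *v ?D i) $ r)\<^sup>2"
      by simp
    also have "\<dots> \<le> (\<Sum>i\<in>K. ((A *v ?D i) $ r)\<^sup>2)"
      using i(1) assms(1) by (intro member_le_sum) auto
    finally show ?thesis .
  qed
  have norm_sq: "(norm v)\<^sup>2 = (\<Sum>r\<in>UNIV. (v $ r)\<^sup>2)" for v :: "real^'m"
    unfolding power2_norm_eq_inner inner_vec_def by (simp add: power2_eq_square)
  have "(norm (A *v X))\<^sup>2 \<le> (\<Sum>r\<in>UNIV. \<Sum>i\<in>K. ((A *v ?D i) $ r)\<^sup>2)"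
    unfolding norm_sq by (intro sum_mono row)
  also have "\<dots> = (\<Sum>i\<in>K. (norm (A *v ?D i))\<^sup>2)"
    unfolding norm_sq by (rule sum.swap)
  finally show ?thesis .
qed

text \<open>
  An injective matrix is bounded below by some \<open>B > 0\<close> and above by some \<open>L > 0\<close>; the previous
  lemma then compares \<open>norm X\<close> with the residuals, with constant \<open>(B / L)\<^sup>2\<close>.
\<close>

lemma sum_local_update_lower_bound:
  fixes A :: "real^'n^'m"
  assumes "finite K" "(\<Union>i\<in>K. R i) = UNIV" and inj: "\<And>x. A *v x = 0 \<Longrightarrow> x = 0"
  obtains c where "c > 0"
    "\<And>X. c * (norm X)\<^sup>2 \<le> (\<Sum>i\<in>K. (norm (local_update A 0 R X i))\<^sup>2)"
proof -
  have lin: "linear ((*v) A)"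
    by (rule matrix_vector_mul_linear)
  have "inj ((*v) A)"
    using lin inj by (simp add: linear_injective_0)
  then obtain B where B: "B > 0" "\<And>x. B * norm x \<le> norm (A *v x)"
    using linear_inj_bounded_below_pos[OF lin] by blast
  obtain L where L: "L > 0" "\<And>x. norm (A *v x) \<le> L * norm x"
    using linear_bounded_pos[OF lin] by blast
  show thesis
  proof
    show "(B / L)\<^sup>2 > 0"
      using B L by simp
    fix X
    let ?D = "local_update A 0 R X"
    have "B\<^sup>2 * (norm X)\<^sup>2 \<le> (norm (A *v X))\<^sup>2"
      using B power_mono[OF B(2)[of X], of 2] by (simp add: power_mult_distrib)
    also have "\<dots> \<le> (\<Sum>i\<in>K. (norm (A *v ?D i))\<^sup>2)"
      using assms by (intro norm_residual_le_sum_local_update)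
    also have "\<dots> \<le> (\<Sum>i\<in>K. L\<^sup>2 * (norm (?D i))\<^sup>2)"
      using L by (intro sum_mono) (metis norm_ge_zero power_mono power_mult_distrib)
    finally have "B\<^sup>2 * (norm X)\<^sup>2 \<le> L\<^sup>2 * (\<Sum>i\<in>K. (norm (?D i))\<^sup>2)"
      by (simp add: sum_distrib_left)
    then show "(B / L)\<^sup>2 * (norm X)\<^sup>2 \<le> (\<Sum>i\<in>K. (norm (?D i))\<^sup>2)"
      using L by (simp add: power_divide field_simps)
  qed
qed

section \<open>The server iterations\<close>

text \<open>
  Pythagoras for the projection onto \<open>v\<^sup>\<bottom>\<close>, written as a Kaczmarz step with right-hand side \<open>0\<close>.
\<close>

lemma norm_hyperplane_projection:
  fixes v x :: "'a::real_inner"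
  assumes "v \<noteq> 0"
  shows "(norm (x + ((0 - v \<bullet> x) / (norm v)\<^sup>2) *\<^sub>R v))\<^sup>2 = (norm x)\<^sup>2 - (v \<bullet> x)\<^sup>2 / (norm v)\<^sup>2"
proof -
  define k where "k = (0 - v \<bullet> x) / (norm v)\<^sup>2"
  have k: "k * (norm v)\<^sup>2 = - (v \<bullet> x)"
    using assms by (simp add: k_def)
  have "(norm (x + k *\<^sub>R v))\<^sup>2 = (norm x)\<^sup>2 + 2 * k * (v \<bullet> x) + k * (k * (norm v)\<^sup>2)"
    unfolding power2_norm_eq_inner
    by (simp add: inner_add_left inner_add_right inner_commute algebra_simps)
  also have "\<dots> = (norm x)\<^sup>2 + k * (v \<bullet> x)"
    by (simp add: k)
  also have "\<dots> = (norm x)\<^sup>2 - (v \<bullet> x)\<^sup>2 / (norm v)\<^sup>2"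
    by (simp add: k_def power2_eq_square)
  finally show ?thesis
    by (simp add: k_def)
qed

text \<open>
  Here \<open>e i\<close> is a lower bound for the decrease caused by row \<open>i\<close>. Rows with \<open>\<Delta> i = 0\<close> are skipped,
  so the step averages over fewer than \<open>card S\<close> rows; as their \<open>e i\<close> is zero, skipping them can only
  raise the average. The choice \<open>e i = (norm (\<Delta> i))\<^sup>2\<close> serves the first step of a round and \<open>e i = 0\<close>
  the later ones.
\<close>

lemma server_step_decrease:
  assumes S: "finite S" "S \<noteq> {}" and d: "\<And>i. i \<in> S \<Longrightarrow> d i = 0"
    and e: "\<And>i. i \<in> S \<Longrightarrow> 0 \<le> e i" "\<And>i. i \<in> S \<Longrightarrow> \<Delta> i = 0 \<Longrightarrow> e i = 0"
      "\<And>i. i \<in> S \<Longrightarrow> \<Delta> i \<noteq> 0 \<Longrightarrow> e i \<le> (\<Delta> i \<bullet> x)\<^sup>2 / (norm (\<Delta> i))\<^sup>2"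
  shows "measure_pmf.expectation (server_step \<Delta> d S x) (\<lambda>y. (norm y)\<^sup>2)
           \<le> (norm x)\<^sup>2 - (\<Sum>i\<in>S. e i) / card S"
proof -
  define J where "J = {i\<in>S. \<Delta> i \<noteq> 0}"
  have J: "J \<subseteq> S" "finite J"
    using S by (auto simp: J_def)
  have sum_J: "(\<Sum>i\<in>S. e i) = (\<Sum>i\<in>J. e i)"
    using S J e(2) by (intro sum.mono_neutral_right) (auto simp: J_def)
  show ?thesis
  proof (cases "J = {}")
    case True
    then show ?thesis
      using sum_J by (simp add: server_step_def J_def[symmetric])
  next
    case False
    have card_J: "card J > 0" "card J \<le> card S"
      using False J S by (auto simp: card_gt_0_iff card_mono)
    have "measure_pmf.expectation (server_step \<Delta> d S x) (\<lambda>y. (norm y)\<^sup>2)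
        = (\<Sum>i\<in>J. (norm (x + ((d i - \<Delta> i \<bullet> x) / (norm (\<Delta> i))\<^sup>2) *\<^sub>R \<Delta> i))\<^sup>2) / card J"
      using False J by (simp add: server_step_def J_def[symmetric] integral_pmf_of_set)
    also have "\<dots> \<le> (\<Sum>i\<in>J. (norm x)\<^sup>2 - e i) / card J"
    proof (intro divide_right_mono sum_mono)
      fix i assume i: "i \<in> J"
      then have "i \<in> S" "\<Delta> i \<noteq> 0"
        by (auto simp: J_def)
      then show "(norm (x + ((d i - \<Delta> i \<bullet> x) / (norm (\<Delta> i))\<^sup>2) *\<^sub>R \<Delta> i))\<^sup>2 \<le> (norm x)\<^sup>2 - e i"
        using norm_hyperplane_projection[of "\<Delta> i" x] e(3)[of i] d[of i] by simp
    qed simp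
    also have "\<dots> = (norm x)\<^sup>2 - (\<Sum>i\<in>J. e i) / card J"
      using card_J by (simp add: sum_subtractf diff_divide_distrib)
    also have "\<dots> \<le> (norm x)\<^sup>2 - (\<Sum>i\<in>J. e i) / card S"
      using card_J J e(1) by (intro diff_left_mono divide_left_mono) (auto intro!: sum_nonneg)
    finally show ?thesis
      by (simp add: sum_J)
  qed
qed

lemma finite_set_pmf_server_step:
  assumes "finite S"
  shows "finite (set_pmf (server_step \<Delta> d S x))"
  using assms by (auto simp: server_step_def Let_def)

text \<open>
  Only the first step is credited with a decrease: it starts at \<open>X\<close>, where
  \<open>\<Delta> i \<bullet> X = - (norm (\<Delta> i))\<^sup>2\<close>. The point reached afterwards may lie on some of the hyperplanes,
  so the later steps are bounded only by the fact that projections do not increase the norm.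
\<close>

lemma server_iterate_decrease:
  assumes S: "finite S" "S \<noteq> {}" and d: "\<And>i. i \<in> S \<Longrightarrow> d i = 0"
    and orth: "\<And>i. i \<in> S \<Longrightarrow> \<Delta> i \<bullet> (\<Delta> i + X) = 0"
  shows "measure_pmf.expectation (server_iterate \<Delta> d S (Suc k) X) (\<lambda>y. (norm y)\<^sup>2)
           \<le> (norm X)\<^sup>2 - (\<Sum>i\<in>S. (norm (\<Delta> i))\<^sup>2) / card S"
proof (induction k)
  case 0
  have "(norm (\<Delta> i))\<^sup>2 \<le> (\<Delta> i \<bullet> X)\<^sup>2 / (norm (\<Delta> i))\<^sup>2" if "i \<in> S" for i
  proof -
    have "\<Delta> i \<bullet> X = - (norm (\<Delta> i))\<^sup>2"
      using orth[OF that] by (simp add: power2_norm_eq_inner inner_add_right)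
    then show ?thesis
      by (simp add: power2_eq_square)
  qed
  then show ?case
    using S d by (simp add: bind_return_pmf server_step_decrease)
next
  case (Suc k)
  have "measure_pmf.expectation (server_iterate \<Delta> d S (Suc (Suc k)) X) (\<lambda>y. (norm y)\<^sup>2)
      \<le> measure_pmf.expectation (server_iterate \<Delta> d S (Suc k) X) (\<lambda>y. (norm y)\<^sup>2)"
    unfolding server_iterate.simps(2)[of \<Delta> d S "Suc k"]
  proof (rule expectation_bind_le)
    show "measure_pmf.expectation (server_step \<Delta> d S x) (\<lambda>y. (norm y)\<^sup>2) \<le> (norm x)\<^sup>2" for x
      using server_step_decrease[of S d "\<lambda>_. 0" \<Delta> x] S d by simp
  qed (simp_all only: finite_set_pmf_server_iterate finite_set_pmf_server_step S(1))
  then show ?case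
    using Suc.IH by linarith
qed

section \<open>Contraction over the rounds\<close>

lemma finite_participant_sets: "finite {S. S \<subseteq> {1..M::nat} \<and> card S = N}"
  by (rule finite_subset[of _ "Pow {1..M}"]) auto

text \<open>
  Each client lies in at least one of the equally likely participant sets, so averaging over
  these sets retains every residual with a positive weight. The crude weight \<open>1 / (card F * N)\<close>,
  for \<open>F\<close> the family of participant sets, is enough here; the exact one would be \<open>1 / M\<close>.
  The maximum with \<open>1/2\<close> in the choice of \<open>\<beta>\<close> only ensures that it is positive.
\<close>

lemma fedrk_round_contraction:
  fixes A :: "real^'n^'m"
  assumes cover: "(\<Union>i\<in>{1..M}. R i) = UNIV" and inj: "\<And>x. A *v x = 0 \<Longrightarrow> x = 0"
    and N: "1 \<le> N" "N \<le> M" and T: "1 \<le> T"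
  obtains \<beta> where "0 < \<beta>" "\<beta> < 1"
    "\<And>X. measure_pmf.expectation (fedrk_round A 0 R M N T X) (\<lambda>x. (norm x)\<^sup>2) \<le> \<beta> * (norm X)\<^sup>2"
proof -
  define F where "F = {S. S \<subseteq> {1..M} \<and> card S = N}"
  have fin_F: "finite F"
    unfolding F_def by (rule finite_participant_sets)
  have fin_S: "finite S" "S \<noteq> {}" "card S = N" if "S \<in> F" for S
    using that N(1) by (auto simp: F_def intro: finite_subset)
  have in_F: "\<exists>S\<in>F. i \<in> S" if i: "i \<in> {1..M}" for i
  proof -
    have "N - 1 \<le> card ({1..M} - {i})"
      using i N by (simp add: card_Diff_singleton)
    then obtain U where U: "U \<subseteq> {1..M} - {i}" "card U = N - 1" "finite U"
      by (rule obtain_subset_with_card_n)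
    then have "i \<notin> U"
      by auto
    then have "insert i U \<in> F"
      using U i N by (auto simp: F_def)
    then show ?thesis
      by blast
  qed
  have F_ne: "F \<noteq> {}"
    using in_F[of 1] N by auto
  have card_F: "card F > 0"
    using F_ne fin_F by (simp add: card_gt_0_iff)
  obtain c where c: "c > 0"
    "\<And>X. c * (norm X)\<^sup>2 \<le> (\<Sum>i\<in>{1..M}. (norm (local_update A 0 R X i))\<^sup>2)"
    using sum_local_update_lower_bound[of "{1..M}" R A] cover inj by auto
  define w where "w = 1 / (real (card F) * real N)"
  have w: "w > 0"
    using card_F N by (simp add: w_def)
  define \<beta> where "\<beta> = max (1/2) (1 - c * w)"
  show thesis
  proof
    show "0 < \<beta>" "\<beta> < 1"
      using c(1) w by (auto simp: \<beta>_def)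
    fix X :: "real^'n"
    define D where "D = local_update A 0 R X"
    have "(\<Sum>i\<in>{1..M}. (norm (D i))\<^sup>2) \<le> (\<Sum>(S, i)\<in>Sigma F (\<lambda>S. S). (norm (D i))\<^sup>2)"
      using fin_F fin_S(1) in_F by (intro sum_le_included[where i = snd]) force+
    also have "\<dots> = (\<Sum>S\<in>F. \<Sum>i\<in>S. (norm (D i))\<^sup>2)"
      using fin_F fin_S(1) by (simp add: sum.Sigma)
    finally have total: "c * (norm X)\<^sup>2 \<le> (\<Sum>S\<in>F. \<Sum>i\<in>S. (norm (D i))\<^sup>2)"
      using c(2)[of X] unfolding D_def by linarith
    have "measure_pmf.expectation (fedrk_round A 0 R M N T X) (\<lambda>x. (norm x)\<^sup>2)
        \<le> measure_pmf.expectation (pmf_of_set F) (\<lambda>S. (norm X)\<^sup>2 - (\<Sum>i\<in>S. (norm (D i))\<^sup>2) / N)"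
      unfolding fedrk_round_def Let_def F_def[symmetric] D_def[symmetric]
    proof (rule expectation_bind_le)
      fix S assume "S \<in> set_pmf (pmf_of_set F)"
      then have S: "S \<in> F"
        using F_ne fin_F by simp
      show "finite (set_pmf (server_iterate D (\<lambda>i. D i \<bullet> (D i + X)) S T X))"
        using fin_S[OF S] by (intro finite_set_pmf_server_iterate)
      have orth: "D i \<bullet> (D i + X) = 0" for i
        unfolding D_def by (rule local_update_orthogonal)
      obtain k where "T = Suc k"
        using T by (cases T) auto
      then show "measure_pmf.expectation (server_iterate D (\<lambda>i. D i \<bullet> (D i + X)) S T X)
          (\<lambda>x. (norm x)\<^sup>2) \<le> (norm X)\<^sup>2 - (\<Sum>i\<in>S. (norm (D i))\<^sup>2) / N"
        using server_iterate_decrease[of S "\<lambda>i. D i \<bullet> (D i + X)" D X k] orth fin_S[OF S] by simp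
    qed (use F_ne fin_F in simp)
    also have "\<dots> = (\<Sum>S\<in>F. (norm X)\<^sup>2 - (\<Sum>i\<in>S. (norm (D i))\<^sup>2) / N) / card F"
      using F_ne fin_F by (simp add: integral_pmf_of_set)
    also have "\<dots> = (norm X)\<^sup>2 - w * (\<Sum>S\<in>F. \<Sum>i\<in>S. (norm (D i))\<^sup>2)"
      using card_F by (simp add: w_def sum_subtractf diff_divide_distrib sum_divide_distrib[symmetric]
          mult.commute)
    also have "\<dots> \<le> (norm X)\<^sup>2 - w * (c * (norm X)\<^sup>2)"
      using total w by (intro diff_left_mono mult_left_mono) auto
    also have "\<dots> = (1 - c * w) * (norm X)\<^sup>2"
      by (simp add: algebra_simps)
    also have "\<dots> \<le> \<beta> * (norm X)\<^sup>2"
      by (intro mult_right_mono) (auto simp: \<beta>_def)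
    finally show "measure_pmf.expectation (fedrk_round A 0 R M N T X) (\<lambda>x. (norm x)\<^sup>2)
        \<le> \<beta> * (norm X)\<^sup>2" .
  qed
qed

theorem theorem2:
  fixes A :: "real^'n^'m" and b :: "real^'m" and X0 :: "real^'n"
    and R :: "nat \<Rightarrow> 'm set" and M N T :: nat
  assumes overdetermined: "CARD('n) < CARD('m)"
    and unique_solution: "\<forall>x. A *v x = b \<longleftrightarrow> x = 0"
    and blocks_cover: "(\<Union>i\<in>{1..M}. R i) = UNIV"
    and blocks_disjoint: "disjoint_family_on R {1..M}"
    and blocks_nonempty: "\<forall>i\<in>{1..M}. R i \<noteq> {}"
    and participants: "1 \<le> N" "N \<le> M"
    and server_steps: "1 \<le> T"
  shows "\<exists>\<beta>::real. 0 < \<beta> \<and> \<beta> < 1 \<and>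
    (\<forall>t. measure_pmf.expectation (fedrk A b R M N T X0 (t + 1)) (\<lambda>x. (norm x)\<^sup>2)
           \<le> \<beta> ^ (t + 1) * (norm X0)\<^sup>2)"
proof -
  have b: "b = 0"
    using unique_solution by (metis matrix_vector_mult_0_right)
  have inj: "x = 0" if "A *v x = 0" for x
    using unique_solution that b by simp
  obtain \<beta> where \<beta>: "0 < \<beta>" "\<beta> < 1"
    "\<And>X. measure_pmf.expectation (fedrk_round A 0 R M N T X) (\<lambda>x. (norm x)\<^sup>2) \<le> \<beta> * (norm X)\<^sup>2"
    using fedrk_round_contraction[OF blocks_cover inj participants server_steps] by blast
  have fin_round: "finite (set_pmf (fedrk_round A 0 R M N T X))" for X
    using finite_set_pmf_fedrk[OF participants(2), of A 0 R T X 1] by (simp add: bind_return_pmf)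
  have "measure_pmf.expectation (fedrk A 0 R M N T X0 t) (\<lambda>x. (norm x)\<^sup>2)
      \<le> \<beta> ^ t * (norm X0)\<^sup>2" for t
  proof (induction t)
    case (Suc t)
    have "measure_pmf.expectation (fedrk A 0 R M N T X0 (Suc t)) (\<lambda>x. (norm x)\<^sup>2)
        \<le> measure_pmf.expectation (fedrk A 0 R M N T X0 t) (\<lambda>x. \<beta> * (norm x)\<^sup>2)"
      unfolding fedrk.simps(2)
      by (rule expectation_bind_le[OF finite_set_pmf_fedrk[OF participants(2)] fin_round \<beta>(3)])
    also have "\<dots> = \<beta> * measure_pmf.expectation (fedrk A 0 R M N T X0 t) (\<lambda>x. (norm x)\<^sup>2)"
      by simp
    also have "\<dots> \<le> \<beta> * (\<beta> ^ t * (norm X0)\<^sup>2)"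
      using Suc.IH \<beta>(1) by (intro mult_left_mono) auto
    finally show ?case
      by (simp add: mult.assoc)
  qed simp
  then show ?thesis
    using \<beta>(1,2) unfolding b by blast
qed

end
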